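(* Let $p\ge1$, let $\{c_n\}_{n\ge1}$ be a sequence of positive numbers, and let $\{X_{n,j},\ 1\le j\le k_n,\ n\ge1\}$ be an array of random variables satisfying the maximal inequality (M) (stated in the context) for some sequences $\{\alpha_n\}$, $\{\beta_n\}$ of nonnegative numbers. Suppose there exists a constant $\delta>0$ such that (a) for any $\lambda>0$, $$\sum_{n=1}^{\infty}c_n\,\mathbb{P}\Big\{\max_{1\le i\le k_n}\Big|\sum_{j=1}^{i}\big(X_{n,j}-\mathbb{E}\,X_{n,j}I_{\{|X_{n,j}|\le\delta\}}\big)\Big|>\lambda\Big\}<\infty;$$ (b) $\max_{1\le j\le k_n}\mathbb{P}\{|X_{n,j}|>\delta\}=o(1)$ and $\sum_{j=1}^{k_n}\mathbb{P}\{|X_{n,j}|>\delta\}=O(1)$ as $n\to\infty$; (c) $\sum_{n=1}^{\infty}\sum_{j=1}^{k_n}c_n(1+\alpha_n)\int_{\delta^p}^{\infty}\mathbb{P}\{|X_{n,j}|^p>t\}\,\mathrm{d}t<\infty$; (d) for some $q>p$, all three of the following hold: $$\sum_{n=1}^{\infty}c_n\beta_n\int_{\delta^p}^{\infty}\Big(\sum_{j=1}^{k_n}\mathbb{P}\{|X_{n,j}|^p>t\}\Big)^{q}\mathrm{d}t<\infty,$$ $$\sum_{n=1}^{\infty}c_n\beta_n\Big(\sum_{j=1}^{k_n}\mathbb{V}\big(X_{n,j}I_{\{|X_{n,j}|\le\delta\}}\big)\Big)^{q}<\infty,\qquad \sum_{n=1}^{\infty}c_n\beta_n\Big(\sum_{j=1}^{k_n}\mathbb{E}|X_{n,j}|I_{\{|X_{n,j}|>\delta\}}\Big)^{q}<\infty.$$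 Then, for all $\varepsilon>0$, $$\sum_{n=1}^{\infty}c_n\,\mathbb{E}\Big[\max_{1\le i\le k_n}\Big|\sum_{j=1}^{i}\big(X_{n,j}-\mathbb{E}\,X_{n,j}I_{\{|X_{n,j}|\le\delta\}}\big)\Big|-\varepsilon\Big]_+^{p}<\infty.$$
   Context: $\{k_n\}_{n\ge1}$ is a sequence of positive integers with $k_n\to\infty$ as $n\to\infty$. $I_A$ is the indicator random variable of the event $A$; $\mathbb{V}$ denotes variance; $x_+=\max(x,0)$ and $[x]_+^p=(x_+)^p$. For $\ell>0$, $g_\ell(x)=\max(\min(x,\ell),-\ell)$ is the truncation at level $\ell$. Inequality (M): an array $\{X_{n,j},\ 1\le j\le k_n,\ n\ge1\}$ of random variables satisfies (M) for sequences $\{\alpha_n\}$, $\{\beta_n\}$ of nonnegative numbers if there exist constants $C_1,C_2>0$, not depending on $n,\ell,\lambda,\eta$, such that for each $n\ge1$ and all $\ell,\lambda,\eta>0$, $$\mathbb{P}\Big\{\max_{1\le i\le k_n}\Big|\sum_{j=1}^{i}[g_\ell(X_{n,j})-\mathbb{E}g_\ell(X_{n,j})]\Big|\ge\lambda\Big\}\le \alpha_n\,\mathbb{P}\Big\{\max_{1\le j\le k_n}|g_\ell(X_{n,j})-\mathbb{E}g_\ell(X_{n,j})|>C_1\eta\Big\}+\beta_n\Big\{\frac{\sum_{j=1}^{k_n}\mathbb{E}[g_\ell(X_{n,j})-\mathbb{E}g_\ell(X_{n,j})]^2}{C_2\lambda\eta}\Big\}^{\lambda/\eta}.$$ *)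

theory Defs
  imports "HOL-Probability.Probability" "HOL-Library.Landau_Symbols"
begin

definition trunc :: "real \<Rightarrow> real \<Rightarrow> real"
  where "trunc l x = max (min x l) (- l)"

definition max_abs_partial_sum :: "nat \<Rightarrow> (nat \<Rightarrow> real) \<Rightarrow> real"
  where "max_abs_partial_sum m y = Max ((\<lambda>i. \<bar>\<Sum>j=1..i. y j\<bar>) ` {1..m})"

definition centered_trunc :: "'a measure \<Rightarrow> real \<Rightarrow> ('a \<Rightarrow> real) \<Rightarrow> 'a \<Rightarrow> real"
  where "centered_trunc M l Y \<omega> = trunc l (Y \<omega>) - (\<integral>\<omega>'. trunc l (Y \<omega>') \<partial>M)"

definition cutoff :: "real \<Rightarrow> ('a \<Rightarrow> real) \<Rightarrow> 'a \<Rightarrow> real"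
  where "cutoff d Y \<omega> = Y \<omega> * indicator {\<omega>'. \<bar>Y \<omega>'\<bar> \<le> d} \<omega>"

text \<open>Row \<open>n\<close> of the array consists of \<open>X n 1, \<dots>, X n (k n)\<close>, and rows are numbered from 1;
  all other values of \<open>X\<close>, \<open>k\<close>, \<open>\<alpha>\<close> and \<open>\<beta>\<close> are irrelevant.
  The truncated variables are bounded, so all expectations below exist.\<close>

definition maximal_inequality ::
    "'a measure \<Rightarrow> (nat \<Rightarrow> nat) \<Rightarrow> (nat \<Rightarrow> nat \<Rightarrow> 'a \<Rightarrow> real) \<Rightarrow> (nat \<Rightarrow> real) \<Rightarrow> (nat \<Rightarrow> real) \<Rightarrow> bool"
  where "maximal_inequality M k X \<alpha> \<beta> \<longleftrightarrow>
    (\<exists>C1>0. \<exists>C2>0. \<forall>n\<ge>1. \<forall>l>0. \<forall>x>0. \<forall>\<eta>>0.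
      measure M {\<omega>\<in>space M. max_abs_partial_sum (k n) (\<lambda>j. centered_trunc M l (X n j) \<omega>) \<ge> x}
      \<le> \<alpha> n * measure M {\<omega>\<in>space M. Max ((\<lambda>j. \<bar>centered_trunc M l (X n j) \<omega>\<bar>) ` {1..k n}) > C1 * \<eta>}
        + \<beta> n * ((\<Sum>j=1..k n. \<integral>\<omega>. (centered_trunc M l (X n j) \<omega>)\<^sup>2 \<partial>M) / (C2 * x * \<eta>)) powr (x / \<eta>))"

text \<open>The maximum over \<open>i\<close> of the absolute partial sums of
  \<open>X n j - E (X n j; \<bar>X n j\<bar> \<le> \<delta>)\<close>.\<close>

definition max_dev ::
    "'a measure \<Rightarrow> (nat \<Rightarrow> nat) \<Rightarrow> (nat \<Rightarrow> nat \<Rightarrow> 'a \<Rightarrow> real) \<Rightarrow> real \<Rightarrow> nat \<Rightarrow> 'a \<Rightarrow> real"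
  where "max_dev M k X \<delta> n \<omega> =
    max_abs_partial_sum (k n) (\<lambda>j. X n j \<omega> - (\<integral>\<omega>'. cutoff \<delta> (X n j) \<omega>' \<partial>M))"

text \<open>This is a Bochner integral, hence 0 if \<open>Y\<close> is not integrable. In the theorem the finiteness
  of the tail integrals of \<open>\<bar>X n j\<bar> powr p\<close>, with \<open>p \<ge> 1\<close> and positive weights, forces
  integrability of every \<open>X n j\<close>.\<close>

definition tail_expectation :: "'a measure \<Rightarrow> real \<Rightarrow> ('a \<Rightarrow> real) \<Rightarrow> real"
  where "tail_expectation M d Y = (\<integral>\<omega>. \<bar>Y \<omega>\<bar> * indicator {\<omega>'. \<bar>Y \<omega>'\<bar> > d} \<omega> \<partial>M)"

end

theory Submission
  imports Defs
begin

text \<open>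
  Write \<open>D\<close> for the maximal deviation of row \<open>n\<close>. The expectation of \<open>[D - \<epsilon>]\<^sub>+\<^sup>p\<close> is the
  integral over \<open>t > 0\<close> of the probability that \<open>[D - \<epsilon>]\<^sub>+\<^sup>p > t\<close>. The part below a constant
  \<open>A\<close> is at most \<open>A\<close> times the probability of \<open>D > \<epsilon>\<close>, which is summable by (a). For
  \<open>t \<ge> A\<close> it suffices to bound the probability of \<open>D > u\<close> with \<open>u = t\<^bsup>1/p\<^esup>\<close>
  (\<open>row_moment_bound\<close>).

  The idea is to truncate the row not at \<open>u\<close> but at a small multiple \<open>l = \<kappa> u\<close>
  (\<open>row_tail_bound\<close>). Let \<open>B\<close> bound the sums in (b). If \<open>\<kappa> \<le> 1 / (2 B)\<close>, then replacing the
  truncated means by the cut off ones moves every partial sum by at most \<open>l B \<le> u / 2\<close>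
  (\<open>trunc_cutoff_drift\<close>), so either some entry exceeds \<open>l\<close>, or the centred truncated partial
  sums reach \<open>u / 2\<close>. To the latter event the maximal inequality applies at height \<open>u / 2\<close>
  with \<open>\<eta> = u / (2 q)\<close>, which makes its exponent equal to \<open>q\<close>. If also \<open>\<kappa> \<le> C1 / (4 q)\<close>,
  its first term vanishes, because a centred truncated variable is at most \<open>2 l \<le> C1 \<eta>\<close>.

  For the second term, a truncated variable is the cut off one plus a remainder whose square is
  at most \<open>l \<bar>X\<bar>\<close>, supported where \<open>\<bar>X\<bar> > \<delta>\<close>. With \<open>V\<close> the sum of the variances of the cut
  off variables and \<open>T\<close> the sum of the tail expectations in (d), the sum of the variances is
  at most \<open>2 V + 2 l T \<le> 2 u (V + T)\<close> for \<open>u \<ge> 1\<close>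
  (\<open>centered_trunc_second_moment\<close>). The maximal inequality thus contributes a constant times
  \<open>\<beta>\<^sub>n (V\<^sup>q + T\<^sup>q) t\<^bsup>-q/p\<^esup>\<close>. Since \<open>q > p\<close>, the power of \<open>t\<close> is integrable at infinity, and
  the conditions on \<open>V\<close> and \<open>T\<close> in (d) give summability. The probabilities that single
  entries exceed \<open>l\<close> integrate, after rescaling \<open>t\<close>, to the quantities in (c).
\<close>

section \<open>Infinite sums in the extended nonnegative reals\<close>

lemma infsum_ennreal_add_finite:
  fixes f g :: "'b \<Rightarrow> ennreal"
  assumes "infsum f A < \<infinity>" "infsum g A < \<infinity>"
  shows "(\<Sum>\<^sub>\<infinity>x\<in>A. f x + g x) < \<infinity>"
proof -
  have "(\<Sum>\<^sub>\<infinity>x\<in>A. f x + g x) = infsum f A + infsum g A"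
    by (intro infsum_add nonneg_summable_on_complete) auto
  with assms show ?thesis by simp
qed

lemma finite_sum_le_infsum_ennreal:
  fixes f :: "'b \<Rightarrow> ennreal"
  assumes "finite F" "F \<subseteq> A"
  shows "sum f F \<le> infsum f A"
proof -
  have "infsum f F \<le> infsum f A"
    using assms by (intro infsum_mono_neutral nonneg_summable_on_complete) auto
  with assms(1) show ?thesis by simp
qed

lemma infsum_ennreal_cmult_finite:
  fixes f :: "'b \<Rightarrow> ennreal"
  assumes "infsum f A < \<infinity>" "a < \<infinity>"
  shows "(\<Sum>\<^sub>\<infinity>x\<in>A. a * f x) < \<infinity>"
proof -
  have "(\<Sum>\<^sub>\<infinity>x\<in>A. a * f x) \<le> a * infsum f A"
  proof (rule infsum_le_finite_sums)
    show "(\<lambda>x. a * f x) summable_on A"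
      by (intro nonneg_summable_on_complete) auto
    fix F assume F: "finite F" "F \<subseteq> A"
    have "sum f F \<le> infsum f A"
      using F by (rule finite_sum_le_infsum_ennreal)
    then show "(\<Sum>x\<in>F. a * f x) \<le> a * infsum f A"
      unfolding sum_distrib_left[symmetric] by (rule mult_left_mono) simp
  qed
  also have "\<dots> < \<infinity>"
    using assms by (simp add: ennreal_mult_less_top)
  finally show ?thesis .
qed

lemma infsum_ennreal_mono_finite:
  fixes f g :: "'b \<Rightarrow> ennreal"
  assumes "infsum g A < \<infinity>" "\<And>x. x \<in> A \<Longrightarrow> f x \<le> g x"
  shows "infsum f A < \<infinity>"
proof -
  have "infsum f A \<le> infsum g A"
    using assms(2) by (intro infsum_mono nonneg_summable_on_complete) auto
  then show ?thesis using assms(1) by (rule le_less_trans)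
qed

lemma infsum_ennreal_term_finite:
  fixes f :: "'b \<Rightarrow> ennreal"
  assumes "infsum f A < \<infinity>" "x \<in> A"
  shows "f x < \<infinity>"
proof -
  have "sum f {x} \<le> infsum f A"
    using assms(2) by (intro finite_sum_le_infsum_ennreal) auto
  then show ?thesis using assms(1) by simp
qed

section \<open>Tail integrals\<close>

lemma (in prob_space) tail_prob_measurable [measurable]:
  fixes f :: "'a \<Rightarrow> real"
  assumes [measurable]: "f \<in> borel_measurable M"
  shows "(\<lambda>t. prob {\<omega>\<in>space M. f \<omega> > t}) \<in> borel_measurable borel"
proof -
  have "mono (\<lambda>t. - prob {\<omega>\<in>space M. f \<omega> > t})"
    by (auto simp: mono_def intro!: finite_measure_mono)
  from borel_measurable_uminus[OF borel_measurable_mono[OF this]] show ?thesis by simp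
qed

lemma (in prob_space) layer_cake:
  fixes f :: "'a \<Rightarrow> real"
  assumes [measurable]: "f \<in> borel_measurable M" and nonneg: "\<And>\<omega>. 0 \<le> f \<omega>"
  shows "(\<integral>\<^sup>+\<omega>. ennreal (f \<omega>) \<partial>M)
    = (\<integral>\<^sup>+t\<in>{0..}. ennreal (prob {\<omega>\<in>space M. f \<omega> > t}) \<partial>lborel)"
proof -
  interpret pair_sigma_finite M lborel ..
  let ?h = "\<lambda>\<omega> t. if 0 \<le> t \<and> t < f \<omega> then 1 else 0 :: ennreal"
  have "(\<integral>\<^sup>+\<omega>. ennreal (f \<omega>) \<partial>M) = (\<integral>\<^sup>+\<omega>. (\<integral>\<^sup>+t. ?h \<omega> t \<partial>lborel) \<partial>M)"
  proof (rule nn_integral_cong)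
    fix \<omega>
    have "(\<integral>\<^sup>+t. ?h \<omega> t \<partial>lborel) = (\<integral>\<^sup>+t. indicator {0..<f \<omega>} t \<partial>lborel)"
      by (intro nn_integral_cong) (auto simp: indicator_def)
    then show "ennreal (f \<omega>) = (\<integral>\<^sup>+t. ?h \<omega> t \<partial>lborel)"
      using nonneg[of \<omega>] by simp
  qed
  also have "\<dots> = (\<integral>\<^sup>+t. (\<integral>\<^sup>+\<omega>. ?h \<omega> t \<partial>M) \<partial>lborel)"
    by (rule Fubini'[symmetric]) measurable
  also have "\<dots> = (\<integral>\<^sup>+t\<in>{0..}. ennreal (prob {\<omega>\<in>space M. f \<omega> > t}) \<partial>lborel)"
  proof (rule nn_integral_cong)
    fix t :: real
    show "(\<integral>\<^sup>+\<omega>. ?h \<omega> t \<partial>M)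
      = ennreal (prob {\<omega>\<in>space M. f \<omega> > t}) * indicator {0..} t"
    proof (cases "t \<ge> 0")
      case True
      have "(\<integral>\<^sup>+\<omega>. ?h \<omega> t \<partial>M) = (\<integral>\<^sup>+\<omega>. indicator {\<omega>\<in>space M. f \<omega> > t} \<omega> \<partial>M)"
        using True by (intro nn_integral_cong) (auto simp: indicator_def)
      then show ?thesis using True by (simp add: emeasure_eq_measure)
    qed simp
  qed
  finally show ?thesis .
qed

text \<open>Below \<open>A\<close> the layer cake integrand is replaced by its largest value, the one at \<open>0\<close>.
  This isolates the one range of \<open>t\<close> in which truncation is of no use.\<close>

lemma (in prob_space) nn_integral_le_tail_integral:
  fixes f :: "'a \<Rightarrow> real"
  assumes [measurable]: "f \<in> borel_measurable M" and nonneg: "\<And>\<omega>. 0 \<le> f \<omega>" and "A \<ge> 0"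
  shows "(\<integral>\<^sup>+\<omega>. ennreal (f \<omega>) \<partial>M) \<le> ennreal (A * prob {\<omega>\<in>space M. f \<omega> > 0})
    + (\<integral>\<^sup>+t\<in>{A..}. ennreal (prob {\<omega>\<in>space M. f \<omega> > t}) \<partial>lborel)"
proof -
  have "(\<integral>\<^sup>+\<omega>. ennreal (f \<omega>) \<partial>M)
      \<le> (\<integral>\<^sup>+t. ennreal (prob {\<omega>\<in>space M. f \<omega> > 0}) * indicator {0..<A} t
          + ennreal (prob {\<omega>\<in>space M. f \<omega> > t}) * indicator {A..} t \<partial>lborel)"
    unfolding layer_cake[OF assms(1,2)]
  proof (intro nn_integral_mono)
    fix t :: real
    have "prob {\<omega>\<in>space M. f \<omega> > t} \<le> prob {\<omega>\<in>space M. f \<omega> > 0}" if "t \<ge> 0"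
      using that by (intro finite_measure_mono) auto
    then show "ennreal (prob {\<omega>\<in>space M. f \<omega> > t}) * indicator {0..} t
      \<le> ennreal (prob {\<omega>\<in>space M. f \<omega> > 0}) * indicator {0..<A} t
          + ennreal (prob {\<omega>\<in>space M. f \<omega> > t}) * indicator {A..} t"
      using \<open>A \<ge> 0\<close> by (auto simp: indicator_def intro!: ennreal_leI)
  qed
  also have "\<dots> = (\<integral>\<^sup>+t. ennreal (prob {\<omega>\<in>space M. f \<omega> > 0}) * indicator {0..<A} t \<partial>lborel)
      + (\<integral>\<^sup>+t\<in>{A..}. ennreal (prob {\<omega>\<in>space M. f \<omega> > t}) \<partial>lborel)"
    by (intro nn_integral_add) auto
  also have "(\<integral>\<^sup>+t. ennreal (prob {\<omega>\<in>space M. f \<omega> > 0}) * indicator {0..<A} t \<partial>lborel)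
      = ennreal (A * prob {\<omega>\<in>space M. f \<omega> > 0})"
    using \<open>A \<ge> 0\<close> by (subst nn_integral_cmult) (simp_all add: ennreal_mult mult.commute)
  finally show ?thesis .
qed

lemma nn_integral_powr_tail:
  fixes A r :: real
  assumes "A > 0" "r > 1"
  shows "(\<integral>\<^sup>+t\<in>{A..}. ennreal (t powr (- r)) \<partial>lborel) = ennreal (A powr (1 - r) / (r - 1))"
proof -
  have "((\<lambda>t. t powr (1 - r) / (1 - r)) \<longlongrightarrow> 0 / (1 - r)) at_top"
    using assms by (intro tendsto_divide tendsto_neg_powr filterlim_ident tendsto_const) auto
  then have "(\<integral>\<^sup>+t\<in>{A..}. ennreal (t powr (- r)) \<partial>lborel)
      = ennreal (0 - A powr (1 - r) / (1 - r))"
    using assms by (intro nn_integral_FTC_atLeast)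
      (auto intro!: derivative_eq_intros simp: divide_simps)
  also have "0 - A powr (1 - r) / (1 - r) = A powr (1 - r) / (r - 1)"
    using assms by (simp add: divide_simps) (simp add: algebra_simps)
  finally show ?thesis .
qed

lemma (in prob_space) tail_integral_rescale:
  fixes f :: "'a \<Rightarrow> real"
  assumes [measurable]: "f \<in> borel_measurable M" and "s > 0" "B \<le> s * A"
  shows "(\<integral>\<^sup>+t\<in>{A..}. ennreal (prob {\<omega>\<in>space M. f \<omega> > s * t}) \<partial>lborel)
    \<le> ennreal (1 / s) * (\<integral>\<^sup>+t\<in>{B..}. ennreal (prob {\<omega>\<in>space M. f \<omega> > t}) \<partial>lborel)"
proof -
  let ?h = "\<lambda>t. ennreal (prob {\<omega>\<in>space M. f \<omega> > t}) * indicator {B..} t"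
  have "(\<integral>\<^sup>+t\<in>{A..}. ennreal (prob {\<omega>\<in>space M. f \<omega> > s * t}) \<partial>lborel)
      \<le> (\<integral>\<^sup>+t. ?h (0 + s * t) \<partial>lborel)"
  proof (intro nn_integral_mono)
    fix t
    have "s * t \<ge> B" if "t \<ge> A"
      using assms(2,3) that mult_left_mono[of A t s] by linarith
    then show "ennreal (prob {\<omega>\<in>space M. f \<omega> > s * t}) * indicator {A..} t \<le> ?h (0 + s * t)"
      by (auto simp: indicator_def)
  qed
  also have "\<dots> = ennreal (1 / s) * (ennreal s * (\<integral>\<^sup>+t. ?h (0 + s * t) \<partial>lborel))"
    using \<open>s > 0\<close> by (simp add: mult.assoc[symmetric] ennreal_mult[symmetric])
  also have "ennreal s * (\<integral>\<^sup>+t. ?h (0 + s * t) \<partial>lborel) = (\<integral>\<^sup>+t. ?h t \<partial>lborel)"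
    using nn_integral_real_affine[of ?h s 0] \<open>s > 0\<close> by simp
  finally show ?thesis .
qed

text \<open>Through this, the summability of the tail integrals makes every entry of the array integrable,
  so that the Bochner integral in \<open>tail_expectation\<close> is a genuine expectation.\<close>

lemma (in prob_space) integrable_if_powr_tail_finite:
  fixes Y :: "'a \<Rightarrow> real"
  assumes [measurable]: "Y \<in> borel_measurable M" and "p \<ge> 1" "A \<ge> 0"
    and fin: "(\<integral>\<^sup>+t\<in>{A..}. ennreal (prob {\<omega>\<in>space M. \<bar>Y \<omega>\<bar> powr p > t}) \<partial>lborel) < \<infinity>"
  shows "integrable M Y"
proof -
  have "(\<integral>\<^sup>+\<omega>. ennreal (\<bar>Y \<omega>\<bar> powr p) \<partial>M) < \<infinity>"
    using nn_integral_le_tail_integral[of "\<lambda>\<omega>. \<bar>Y \<omega>\<bar> powr p" A] fin \<open>A \<ge> 0\<close>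
    by (auto simp: less_top[symmetric] top_unique)
  then have "integrable M (\<lambda>\<omega>. \<bar>Y \<omega>\<bar> powr p)"
    by (intro integrableI_nonneg) auto
  then have "integrable M (\<lambda>\<omega>. 1 + \<bar>Y \<omega>\<bar> powr p)" by simp
  then show ?thesis
  proof (rule Bochner_Integration.integrable_bound)
    have "\<bar>Y \<omega>\<bar> \<le> 1 + \<bar>Y \<omega>\<bar> powr p" for \<omega>
    proof (cases "\<bar>Y \<omega>\<bar> \<le> 1")
      case False
      then have "\<bar>Y \<omega>\<bar> powr 1 \<le> \<bar>Y \<omega>\<bar> powr p" using \<open>p \<ge> 1\<close> by (intro powr_mono) auto
      then show ?thesis using False by simp
    qed (auto intro: order_trans[of _ 1])
    then show "AE \<omega> in M. norm (Y \<omega>) \<le> norm (1 + \<bar>Y \<omega>\<bar> powr p)"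
      by (intro AE_I2) (simp only: real_norm_def, smt (verit) powr_ge_zero)
  qed simp
qed

section \<open>Truncation against cutting off\<close>

lemma trunc_measurable [measurable]: "trunc l \<in> borel_measurable borel"
  unfolding trunc_def by measurable

lemma cutoff_measurable [measurable]:
  assumes [measurable]: "Y \<in> borel_measurable M"
  shows "cutoff d Y \<in> borel_measurable M"
proof -
  have "cutoff d Y = (\<lambda>\<omega>. if \<bar>Y \<omega>\<bar> \<le> d then Y \<omega> else 0)"
    by (auto simp: cutoff_def fun_eq_iff indicator_def)
  then show ?thesis by simp
qed

lemma abs_trunc_le: "l \<ge> 0 \<Longrightarrow> \<bar>trunc l x\<bar> \<le> l"
  and abs_trunc_le_abs: "l \<ge> 0 \<Longrightarrow> \<bar>trunc l x\<bar> \<le> \<bar>x\<bar>"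
  and trunc_eq: "\<bar>x\<bar> \<le> l \<Longrightarrow> trunc l x = x"
  by (auto simp: trunc_def)

lemma (in prob_space) integrable_trunc:
  assumes [measurable]: "Y \<in> borel_measurable M" and "l \<ge> 0"
  shows "integrable M (\<lambda>\<omega>. trunc l (Y \<omega>))"
  using abs_trunc_le[OF \<open>l \<ge> 0\<close>] by (intro integrable_const_bound[of _ l]) auto

lemma (in prob_space) integrable_cutoff:
  assumes [measurable]: "Y \<in> borel_measurable M" and "d \<ge> 0"
  shows "integrable M (cutoff d Y)"
  using \<open>d \<ge> 0\<close> by (intro integrable_const_bound[of _ d]) (auto simp: cutoff_def indicator_def)

lemma (in prob_space) abs_centered_trunc_le:
  assumes [measurable]: "Y \<in> borel_measurable M" and "l \<ge> 0"
  shows "\<bar>centered_trunc M l Y \<omega>\<bar> \<le> 2 * l"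
proof -
  have "\<bar>expectation (\<lambda>\<omega>. trunc l (Y \<omega>))\<bar> \<le> expectation (\<lambda>\<omega>. \<bar>trunc l (Y \<omega>)\<bar>)"
    by (rule integral_abs_bound)
  also have "\<dots> \<le> expectation (\<lambda>_. l)"
    using abs_trunc_le[OF \<open>l \<ge> 0\<close>] integrable_trunc[OF assms]
    by (intro integral_mono) auto
  finally have "\<bar>expectation (\<lambda>\<omega>. trunc l (Y \<omega>))\<bar> \<le> l" by (simp add: prob_space)
  then show ?thesis
    using abs_trunc_le[OF \<open>l \<ge> 0\<close>, of "Y \<omega>"] unfolding centered_trunc_def by linarith
qed

text \<open>Truncating and cutting off at lower level agree except where \<open>\<bar>Y\<bar> > d\<close>, where
  the cut off variable is \<open>0\<close> and the truncated one at most \<open>l\<close>. The bound is linear in \<open>l\<close>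
  with the tail probability at the fixed level \<open>d\<close> as slope, so it is a small fraction of \<open>u\<close>
  once \<open>l\<close> is a small fraction of \<open>u\<close>.\<close>

lemma (in prob_space) trunc_cutoff_drift:
  assumes [measurable]: "Y \<in> borel_measurable M" and "0 \<le> d" "d \<le> l"
  shows "\<bar>expectation (\<lambda>\<omega>. trunc l (Y \<omega>)) - expectation (cutoff d Y)\<bar>
    \<le> l * prob {\<omega>\<in>space M. \<bar>Y \<omega>\<bar> > d}"
proof -
  let ?E = "{\<omega>\<in>space M. \<bar>Y \<omega>\<bar> > d}"
  have l: "l \<ge> 0" using assms by simp
  note int = integrable_trunc[OF assms(1) l] integrable_cutoff[OF assms(1,2)]
  have "\<bar>expectation (\<lambda>\<omega>. trunc l (Y \<omega>)) - expectation (cutoff d Y)\<bar>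
      = \<bar>expectation (\<lambda>\<omega>. trunc l (Y \<omega>) - cutoff d Y \<omega>)\<bar>"
    using int by simp
  also have "\<dots> \<le> expectation (\<lambda>\<omega>. \<bar>trunc l (Y \<omega>) - cutoff d Y \<omega>\<bar>)"
    by (rule integral_abs_bound)
  also have "\<dots> \<le> expectation (\<lambda>\<omega>. l * indicator ?E \<omega>)"
  proof (intro integral_mono)
    show "integrable M (\<lambda>\<omega>. l * indicator ?E \<omega>)"
      by (intro integrable_mult_right integrable_real_indicator) (auto simp: emeasure_eq_measure)
    fix \<omega> assume "\<omega> \<in> space M"
    then show "\<bar>trunc l (Y \<omega>) - cutoff d Y \<omega>\<bar> \<le> l * indicator ?E \<omega>"
      using \<open>d \<le> l\<close> abs_trunc_le[OF l, of "Y \<omega>"]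
      by (cases "\<bar>Y \<omega>\<bar> \<le> d") (auto simp: cutoff_def trunc_eq)
  qed (use int in auto)
  also have "\<dots> = l * prob ?E" by simp
  finally show ?thesis .
qed

text \<open>On \<open>\<bar>Y\<bar> > d\<close> the square of the truncated variable is at most \<open>l \<bar>Y\<bar>\<close>, one
  factor being bounded by the truncation level and the other by \<open>\<bar>Y\<bar>\<close>. This keeps the growth in
  \<open>l\<close> linear, one power less than the denominator \<open>u\<^sup>2\<close> of the maximal inequality.\<close>

lemma (in prob_space) centered_trunc_second_moment:
  assumes Y: "integrable M Y" and "0 \<le> d" "d \<le> l"
  shows "expectation (\<lambda>\<omega>. (centered_trunc M l Y \<omega>)\<^sup>2)
    \<le> 2 * variance (cutoff d Y) + 2 * l * tail_expectation M d Y"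
proof -
  have [measurable]: "Y \<in> borel_measurable M" using Y by simp
  have l: "l \<ge> 0" using assms by simp
  let ?T = "\<lambda>\<omega>. trunc l (Y \<omega>)" and ?m = "expectation (cutoff d Y)"
  let ?W = "\<lambda>\<omega>. \<bar>Y \<omega>\<bar> * indicator {\<omega>'. \<bar>Y \<omega>'\<bar> > d} \<omega>"
  have W: "integrable M ?W"
  proof (rule Bochner_Integration.integrable_bound[OF Y])
    have "?W = (\<lambda>\<omega>. if \<bar>Y \<omega>\<bar> > d then \<bar>Y \<omega>\<bar> else 0)"
      by (auto simp: fun_eq_iff indicator_def)
    then show "?W \<in> borel_measurable M" by simp
  qed (auto simp: indicator_def)
  have C: "\<bar>cutoff d Y \<omega>\<bar> \<le> d" for \<omega>
    using assms by (auto simp: cutoff_def indicator_def)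
  have square_int: "integrable M (\<lambda>\<omega>. (Z \<omega> - a)\<^sup>2)"
    if [measurable]: "Z \<in> borel_measurable M" and Z: "\<And>\<omega>. \<bar>Z \<omega>\<bar> \<le> b" for Z and a b :: real
  proof (rule integrable_const_bound[of _ "(b + \<bar>a\<bar>)\<^sup>2"])
    have "\<bar>Z \<omega> - a\<bar> \<le> \<bar>b + \<bar>a\<bar>\<bar>" for \<omega> using Z[of \<omega>] by linarith
    then have "(Z \<omega> - a)\<^sup>2 \<le> (b + \<bar>a\<bar>)\<^sup>2" for \<omega> by (simp add: abs_le_square_iff)
    then show "AE \<omega> in M. norm ((Z \<omega> - a)\<^sup>2) \<le> (b + \<bar>a\<bar>)\<^sup>2" by simp
  qed measurable
  have C2: "integrable M (\<lambda>\<omega>. (cutoff d Y \<omega> - a)\<^sup>2)" for a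
    by (rule square_int[OF _ C]) measurable
  have T2: "integrable M (\<lambda>\<omega>. (?T \<omega> - a)\<^sup>2)" for a
    by (rule square_int[OF _ abs_trunc_le[OF l]]) measurable
  \<comment> \<open>The mean minimises the mean square distance to a constant, so the truncated variable may
    be centred at the mean of the cut off one.\<close>
  have "expectation (\<lambda>\<omega>. (centered_trunc M l Y \<omega>)\<^sup>2) \<le> expectation (\<lambda>\<omega>. (?T \<omega> - ?m)\<^sup>2)"
  proof -
    let ?e = "expectation ?T"
    have T: "integrable M ?T" by (rule integrable_trunc) (use l in auto)
    have "expectation (\<lambda>\<omega>. (?T \<omega> - ?m)\<^sup>2)
        = expectation (\<lambda>\<omega>. (?T \<omega> - ?e)\<^sup>2 + (2 * (?e - ?m) * (?T \<omega> - ?e) + (?e - ?m)\<^sup>2))"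
      by (intro Bochner_Integration.integral_cong refl) (simp add: power2_eq_square algebra_simps)
    also have "\<dots> = expectation (\<lambda>\<omega>. (?T \<omega> - ?e)\<^sup>2)
        + expectation (\<lambda>\<omega>. 2 * (?e - ?m) * (?T \<omega> - ?e) + (?e - ?m)\<^sup>2)"
      by (intro Bochner_Integration.integral_add T2) (use T in simp)
    also have "expectation (\<lambda>\<omega>. 2 * (?e - ?m) * (?T \<omega> - ?e) + (?e - ?m)\<^sup>2) = (?e - ?m)\<^sup>2"
      using T by (simp add: prob_space)
    finally show ?thesis by (simp add: centered_trunc_def)
  qed
  also have "\<dots> \<le> expectation (\<lambda>\<omega>. 2 * (cutoff d Y \<omega> - ?m)\<^sup>2 + 2 * l * ?W \<omega>)"
  proof (intro integral_mono T2)
    show "integrable M (\<lambda>\<omega>. 2 * (cutoff d Y \<omega> - ?m)\<^sup>2 + 2 * l * ?W \<omega>)"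
      using C2[of ?m] W by (intro Bochner_Integration.integrable_add integrable_mult_right) auto
    fix \<omega>
    show "(?T \<omega> - ?m)\<^sup>2 \<le> 2 * (cutoff d Y \<omega> - ?m)\<^sup>2 + 2 * l * ?W \<omega>"
    proof (cases "\<bar>Y \<omega>\<bar> \<le> d")
      case True
      then show ?thesis using assms by (simp add: trunc_eq cutoff_def)
    next
      case False
      have "(?T \<omega>)\<^sup>2 \<le> l * \<bar>Y \<omega>\<bar>"
        using mult_mono[OF abs_trunc_le[OF l] abs_trunc_le_abs[OF l], of "Y \<omega>" "Y \<omega>"] l
        by (simp add: power2_eq_square)
      \<comment> \<open>Off the cutoff set the claim is \<open>(T - m)\<^sup>2 \<le> 2 m\<^sup>2 + 2 l \<bar>Y\<bar>\<close>, and
        \<open>(T - m)\<^sup>2 = 2 T\<^sup>2 + 2 m\<^sup>2 - (T + m)\<^sup>2\<close>.\<close>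
      moreover have "0 \<le> (?T \<omega> + ?m)\<^sup>2" by simp
      ultimately show ?thesis using False
        by (simp add: cutoff_def power2_eq_square algebra_simps)
    qed
  qed
  also have "\<dots> = 2 * variance (cutoff d Y) + 2 * l * tail_expectation M d Y"
    using C2[of ?m] W by (subst Bochner_Integration.integral_add)
      (auto simp: tail_expectation_def mult.assoc)
  finally show ?thesis .
qed

section \<open>Maxima of partial sums\<close>

lemma abs_partial_sum_le_max: "i \<in> {1..m} \<Longrightarrow> \<bar>\<Sum>j=1..i. y j\<bar> \<le> max_abs_partial_sum m y"
  unfolding max_abs_partial_sum_def by (intro Max_ge) auto

lemma max_abs_partial_sum_attained:
  assumes "m > 0"
  obtains i where "i \<in> {1..m}" "max_abs_partial_sum m y = \<bar>\<Sum>j=1..i. y j\<bar>"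
proof -
  have "max_abs_partial_sum m y \<in> (\<lambda>i. \<bar>\<Sum>j=1..i. y j\<bar>) ` {1..m}"
    unfolding max_abs_partial_sum_def using assms by (intro Max_in) auto
  then show ?thesis using that by auto
qed

lemma max_abs_partial_sum_perturb:
  assumes "m > 0" "(\<Sum>j=1..m. \<bar>y j - z j\<bar>) \<le> r"
  shows "max_abs_partial_sum m y \<le> max_abs_partial_sum m z + r"
proof -
  obtain i where i: "i \<in> {1..m}" "max_abs_partial_sum m y = \<bar>\<Sum>j=1..i. y j\<bar>"
    using max_abs_partial_sum_attained[OF assms(1)] .
  have "\<bar>(\<Sum>j=1..i. y j) - (\<Sum>j=1..i. z j)\<bar> \<le> (\<Sum>j=1..i. \<bar>y j - z j\<bar>)"
    unfolding sum_subtractf[symmetric] by (rule sum_abs)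
  also have "\<dots> \<le> (\<Sum>j=1..m. \<bar>y j - z j\<bar>)"
    using i by (intro sum_mono2) auto
  finally show ?thesis
    using abs_partial_sum_le_max[OF i(1), of z] i(2) assms(2) by linarith
qed

lemma max_abs_partial_sum_measurable:
  assumes "m > 0" and [measurable]: "\<And>j. j \<in> {1..m} \<Longrightarrow> Y j \<in> borel_measurable M"
  shows "(\<lambda>\<omega>. max_abs_partial_sum m (\<lambda>j. Y j \<omega>)) \<in> borel_measurable M"
  unfolding max_abs_partial_sum_def
  using assms by (intro borel_measurable_Max borel_measurable_abs borel_measurable_sum) auto

section \<open>One row of the array\<close>

lemma powr_sum_le:
  fixes x y q :: real
  assumes "x \<ge> 0" "y \<ge> 0" "q \<ge> 0"
  shows "(x + y) powr q \<le> 2 powr q * (x powr q + y powr q)"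
proof -
  have "(x + y) powr q \<le> (2 * max x y) powr q"
    using assms by (intro powr_mono2) auto
  also have "\<dots> = 2 powr q * max x y powr q"
    using assms by (simp add: powr_mult)
  also have "max x y powr q \<le> x powr q + y powr q" by (simp add: max_def)
  finally show ?thesis by simp
qed

text \<open>The conditions on \<open>\<kappa>\<close> say that truncation at \<open>\<kappa> u\<close> shifts the partial sums by at most
  \<open>u / 2\<close>, and that it leaves no centred summand large enough to reach the threshold
  \<open>C1 \<eta>\<close>. The latter makes the event in the term with coefficient \<open>a\<close> impossible.\<close>

lemma (in prob_space) row_tail_bound:
  fixes Y :: "nat \<Rightarrow> 'a \<Rightarrow> real" and m :: nat
  assumes "m > 0" and Y: "\<And>j. j \<in> {1..m} \<Longrightarrow> integrable M (Y j)"
    and max_ineq: "\<And>l x \<eta>. l > 0 \<Longrightarrow> x > 0 \<Longrightarrow> \<eta> > 0 \<Longrightarrow>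
      prob {\<omega>\<in>space M. max_abs_partial_sum m (\<lambda>j. centered_trunc M l (Y j) \<omega>) \<ge> x}
      \<le> a * prob {\<omega>\<in>space M. Max ((\<lambda>j. \<bar>centered_trunc M l (Y j) \<omega>\<bar>) ` {1..m}) > C1 * \<eta>}
        + b * ((\<Sum>j=1..m. expectation (\<lambda>\<omega>. (centered_trunc M l (Y j) \<omega>)\<^sup>2)) / (C2 * x * \<eta>)) powr (x / \<eta>)"
    and "b \<ge> 0" "C2 > 0" "q > 0" "\<delta> > 0" "0 < \<kappa>" "\<kappa> \<le> 1"
    and drift: "\<kappa> * (\<Sum>j=1..m. prob {\<omega>\<in>space M. \<bar>Y j \<omega>\<bar> > \<delta>}) \<le> 1 / 2"
    and small: "\<kappa> \<le> C1 / (4 * q)"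
    and "u \<ge> 1" "\<delta> \<le> \<kappa> * u"
  defines "V \<equiv> \<Sum>j=1..m. variance (cutoff \<delta> (Y j))"
    and "T \<equiv> \<Sum>j=1..m. tail_expectation M \<delta> (Y j)"
  shows "prob {\<omega>\<in>space M. max_abs_partial_sum m (\<lambda>j. Y j \<omega> - expectation (cutoff \<delta> (Y j))) > u}
    \<le> (\<Sum>j=1..m. prob {\<omega>\<in>space M. \<bar>Y j \<omega>\<bar> > \<kappa> * u})
      + b * (16 * q / C2) powr q * (V powr q + T powr q) * u powr (- q)"
proof -
  define l where "l = \<kappa> * u"
  have l: "l > 0" "l \<le> u" "\<delta> \<le> l"
    using \<open>0 < \<kappa>\<close> \<open>\<kappa> \<le> 1\<close> \<open>u \<ge> 1\<close> \<open>\<delta> \<le> \<kappa> * u\<close> by (auto simp: l_def mult_le_cancel_right1)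
  have meas [measurable]: "Y j \<in> borel_measurable M" if "j \<in> {1..m}" for j
    using Y[OF that] by simp
  let ?D = "\<lambda>\<omega>. max_abs_partial_sum m (\<lambda>j. Y j \<omega> - expectation (cutoff \<delta> (Y j)))"
  let ?Z = "\<lambda>\<omega>. max_abs_partial_sum m (\<lambda>j. centered_trunc M l (Y j) \<omega>)"
  let ?E = "\<lambda>j. {\<omega>\<in>space M. \<bar>Y j \<omega>\<bar> > l}"
  let ?F = "{\<omega>\<in>space M. ?Z \<omega> \<ge> u / 2}"
  have Z [measurable]: "?Z \<in> borel_measurable M"
    using \<open>m > 0\<close> unfolding centered_trunc_def
    by (intro max_abs_partial_sum_measurable) auto
  have EF [measurable]: "\<And>j. j \<in> {1..m} \<Longrightarrow> ?E j \<in> events" "?F \<in> events" by measurable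
  have shift: "(\<Sum>j=1..m. \<bar>expectation (\<lambda>\<omega>. trunc l (Y j \<omega>)) - expectation (cutoff \<delta> (Y j))\<bar>) \<le> u / 2"
  proof -
    have "(\<Sum>j=1..m. \<bar>expectation (\<lambda>\<omega>. trunc l (Y j \<omega>)) - expectation (cutoff \<delta> (Y j))\<bar>)
        \<le> (\<Sum>j=1..m. l * prob {\<omega>\<in>space M. \<bar>Y j \<omega>\<bar> > \<delta>})"
      using l \<open>\<delta> > 0\<close> by (intro sum_mono trunc_cutoff_drift meas) auto
    also have "\<dots> = u * (\<kappa> * (\<Sum>j=1..m. prob {\<omega>\<in>space M. \<bar>Y j \<omega>\<bar> > \<delta>}))"
      by (simp add: l_def sum_distrib_left mult_ac)
    also have "\<dots> \<le> u * (1 / 2)"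
      using drift \<open>u \<ge> 1\<close> by (intro mult_left_mono) auto
    finally show ?thesis by simp
  qed
  have "{\<omega>\<in>space M. ?D \<omega> > u} \<subseteq> (\<Union>j\<in>{1..m}. ?E j) \<union> ?F"
  proof
    fix \<omega> assume \<omega>: "\<omega> \<in> {\<omega>\<in>space M. ?D \<omega> > u}"
    show "\<omega> \<in> (\<Union>j\<in>{1..m}. ?E j) \<union> ?F"
    proof (cases "\<exists>j\<in>{1..m}. \<bar>Y j \<omega>\<bar> > l")
      case False
      have "(\<Sum>j=1..m. \<bar>(Y j \<omega> - expectation (cutoff \<delta> (Y j))) - centered_trunc M l (Y j) \<omega>\<bar>)
          = (\<Sum>j=1..m. \<bar>expectation (\<lambda>\<omega>. trunc l (Y j \<omega>)) - expectation (cutoff \<delta> (Y j))\<bar>)"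
        using False by (intro sum.cong refl) (auto simp: centered_trunc_def trunc_eq not_less)
      then have "?D \<omega> \<le> ?Z \<omega> + u / 2"
        using shift \<open>m > 0\<close> by (intro max_abs_partial_sum_perturb) simp_all
      then show ?thesis using \<omega> by auto
    qed (use \<omega> in auto)
  qed
  then have "prob {\<omega>\<in>space M. ?D \<omega> > u} \<le> prob ((\<Union>j\<in>{1..m}. ?E j) \<union> ?F)"
    by (intro finite_measure_mono) auto
  also have "\<dots> \<le> prob (\<Union>j\<in>{1..m}. ?E j) + prob ?F"
    by (intro measure_Un_le) auto
  also have "prob (\<Union>j\<in>{1..m}. ?E j) \<le> (\<Sum>j=1..m. prob (?E j))"
    by (intro finite_measure_subadditive_finite) auto
  also have "prob ?F \<le> b * (16 * q / C2) powr q * (V powr q + T powr q) * u powr (- q)"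
  proof -
    define S where "S = (\<Sum>j=1..m. expectation (\<lambda>\<omega>. (centered_trunc M l (Y j) \<omega>)\<^sup>2))"
    \<comment> \<open>The maximal inequality is used at height \<open>u / 2\<close>; this \<open>\<eta>\<close> turns its exponent
      into \<open>q\<close>.\<close>
    let ?\<eta> = "u / (2 * q)"
    have "2 * l \<le> C1 * ?\<eta>"
      using mult_right_mono[OF small, of "2 * u"] \<open>u \<ge> 1\<close> \<open>q > 0\<close>
      by (simp add: l_def field_simps)
    then have empty: "{\<omega>\<in>space M. Max ((\<lambda>j. \<bar>centered_trunc M l (Y j) \<omega>\<bar>) ` {1..m}) > C1 * ?\<eta>} = {}"
      using \<open>m > 0\<close> order_trans[OF abs_centered_trunc_le[OF meas less_imp_le[OF l(1)]]]
      by (auto simp: Max_gr_iff not_less)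
    have "prob ?F \<le> a * prob {} + b * (S / (C2 * (u / 2) * ?\<eta>)) powr ((u / 2) / ?\<eta>)"
      unfolding S_def empty[symmetric] using l \<open>u \<ge> 1\<close> \<open>q > 0\<close> by (intro max_ineq) auto
    then have "prob ?F \<le> b * (S / (C2 * (u / 2) * ?\<eta>)) powr ((u / 2) / ?\<eta>)"
      unfolding measure_empty by simp
    also have "(u / 2) / ?\<eta> = q" using \<open>u \<ge> 1\<close> by simp
    also have "S / (C2 * (u / 2) * ?\<eta>) = S * (4 * q / (C2 * u\<^sup>2))"
      using \<open>u \<ge> 1\<close> \<open>C2 > 0\<close> \<open>q > 0\<close> by (simp add: field_simps power2_eq_square)
    finally have F: "prob ?F \<le> b * (S * (4 * q / (C2 * u\<^sup>2))) powr q" .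
    have V: "V \<ge> 0" and T: "T \<ge> 0" and "S \<ge> 0"
      by (auto simp: V_def T_def S_def tail_expectation_def intro!: sum_nonneg Bochner_Integration.integral_nonneg)
    have "S \<le> (\<Sum>j=1..m. 2 * variance (cutoff \<delta> (Y j)) + 2 * l * tail_expectation M \<delta> (Y j))"
      unfolding S_def using l \<open>\<delta> > 0\<close> by (intro sum_mono centered_trunc_second_moment Y) auto
    also have "\<dots> = 2 * V + 2 * l * T"
      by (simp add: V_def T_def sum.distrib sum_distrib_left)
    \<comment> \<open>As \<open>u \<ge> 1\<close>, one factor \<open>u\<close> may be spent on \<open>V\<close>, so that both terms decay
      like \<open>u\<^bsup>-q\<^esup>\<close> in the end.\<close>
    also have "\<dots> \<le> 2 * u * (V + T)"
      using mult_right_mono[OF l(2) T] mult_right_mono[OF \<open>u \<ge> 1\<close> V] by (simp add: algebra_simps)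
    finally have "S * (4 * q / (C2 * u\<^sup>2)) \<le> 2 * u * (V + T) * (4 * q / (C2 * u\<^sup>2))"
      using \<open>C2 > 0\<close> \<open>q > 0\<close> by (intro mult_right_mono) auto
    also have "\<dots> = (8 * q / C2) * (V + T) * inverse u"
      using \<open>u \<ge> 1\<close> \<open>C2 > 0\<close> by (simp add: field_simps power2_eq_square)
    finally have "(S * (4 * q / (C2 * u\<^sup>2))) powr q \<le> ((8 * q / C2) * (V + T) * inverse u) powr q"
      using \<open>S \<ge> 0\<close> \<open>C2 > 0\<close> \<open>q > 0\<close> by (intro powr_mono2) auto
    also have "\<dots> = (8 * q / C2) powr q * (V + T) powr q * u powr (- q)"
    proof -
      have split: "(r * (V + T) * inverse u) powr q = r powr q * (V + T) powr q * u powr (- q)"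
        if "r \<ge> 0" for r
        using that V T \<open>u \<ge> 1\<close> by (simp add: powr_mult powr_minus inverse_powr)
      show ?thesis by (rule split) (use \<open>C2 > 0\<close> \<open>q > 0\<close> in simp)
    qed
    also have "\<dots> \<le> (8 * q / C2) powr q * (2 powr q * (V powr q + T powr q)) * u powr (- q)"
      using V T \<open>q > 0\<close> by (intro mult_right_mono mult_left_mono powr_sum_le) auto
    also have "\<dots> = (16 * q / C2) powr q * (V powr q + T powr q) * u powr (- q)"
    proof -
      have "(8 * q / C2) powr q * 2 powr q = ((8 * q / C2) * 2) powr q"
        by (rule powr_mult[symmetric])
      then show ?thesis by simp
    qed
    finally show ?thesis
      using F mult_left_mono[OF _ \<open>b \<ge> 0\<close>] by (fastforce simp: mult.assoc)
  qed
  finally show ?thesis by (simp add: l_def)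
qed

text \<open>The tail bound is applied with \<open>u = t\<^bsup>1/p\<^esup>\<close>. The lower bounds on \<open>A\<close> guarantee
  for all \<open>t \<ge> A\<close> that \<open>u \<ge> 1\<close> and \<open>\<delta> \<le> \<kappa> u\<close>, and that rescaling by \<open>\<kappa>\<^sup>p\<close> maps
  the range \<open>t \<ge> A\<close> into the range \<open>t \<ge> \<delta>\<^sup>p\<close> of the tail integrals.\<close>

lemma (in prob_space) row_moment_bound:
  fixes D :: "'a \<Rightarrow> real" and Y :: "nat \<Rightarrow> 'a \<Rightarrow> real" and p q :: real
  assumes [measurable]: "D \<in> borel_measurable M" "\<And>j. j \<in> J \<Longrightarrow> Y j \<in> borel_measurable M"
    and "finite J" "p \<ge> 1" "q > p" "\<kappa> > 0" "\<delta> > 0" "R \<ge> 0" "\<epsilon> > 0"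
    and tail: "\<And>u. u \<ge> 1 \<Longrightarrow> \<delta> \<le> \<kappa> * u \<Longrightarrow>
      prob {\<omega>\<in>space M. D \<omega> > u} \<le> (\<Sum>j\<in>J. prob {\<omega>\<in>space M. \<bar>Y j \<omega>\<bar> > \<kappa> * u}) + R * u powr (- q)"
    and "A \<ge> 1" "\<delta> powr p \<le> \<kappa> powr p * A"
  shows "(\<integral>\<^sup>+\<omega>. ennreal ((max (D \<omega> - \<epsilon>) 0) powr p) \<partial>M)
    \<le> ennreal (A * prob {\<omega>\<in>space M. D \<omega> > \<epsilon>})
      + ennreal (1 / \<kappa> powr p) * (\<Sum>j\<in>J. \<integral>\<^sup>+t\<in>{\<delta> powr p..}. ennreal (prob {\<omega>\<in>space M. \<bar>Y j \<omega>\<bar> powr p > t}) \<partial>lborel)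
      + ennreal (R * (A powr (1 - q / p) / (q / p - 1)))"
proof -
  let ?f = "\<lambda>\<omega>. (max (D \<omega> - \<epsilon>) 0) powr p"
  let ?s = "\<kappa> powr p"
  let ?P = "\<lambda>j t. ennreal (prob {\<omega>\<in>space M. \<bar>Y j \<omega>\<bar> powr p > t})"
  have pos: "{\<omega>\<in>space M. ?f \<omega> > 0} = {\<omega>\<in>space M. D \<omega> > \<epsilon>}"
    by (auto simp: max_def)
  have pointwise: "ennreal (prob {\<omega>\<in>space M. ?f \<omega> > t})
      \<le> (\<Sum>j\<in>J. ?P j (?s * t)) + ennreal R * ennreal (t powr (- (q / p)))" if "t \<ge> A" for t
  proof -
    define u where "u = t powr (1 / p)"
    have t: "t \<ge> 1" using that \<open>A \<ge> 1\<close> by simp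
    have u: "u \<ge> 1" "u powr p = t" "u powr (- q) = t powr (- (q / p))"
      using t \<open>p \<ge> 1\<close> by (auto simp: u_def powr_powr ge_one_powr_ge_zero)
    have "\<delta> powr p \<le> ?s * t"
      using \<open>\<delta> powr p \<le> ?s * A\<close> mult_left_mono[OF that, of ?s] by simp
    also have "\<dots> = (\<kappa> * u) powr p"
      using u \<open>\<kappa> > 0\<close> by (simp add: powr_mult)
    finally have \<delta>: "\<delta> \<le> \<kappa> * u"
      using \<open>p \<ge> 1\<close> u(1) \<open>\<kappa> > 0\<close> powr_less_mono2[of p "\<kappa> * u" \<delta>]
      by (cases "\<delta> \<le> \<kappa> * u") (simp_all add: not_le)
    have "{\<omega>\<in>space M. ?f \<omega> > t} \<subseteq> {\<omega>\<in>space M. D \<omega> > u}"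
    proof safe
      fix \<omega> assume "?f \<omega> > t"
      then have "max (D \<omega> - \<epsilon>) 0 > u"
        using u \<open>p \<ge> 1\<close> powr_mono2[of p "max (D \<omega> - \<epsilon>) 0" u] by (force simp: not_less[symmetric])
      then show "D \<omega> > u" using u(1) \<open>\<epsilon> > 0\<close> by (auto simp: max_def split: if_splits)
    qed
    then have "prob {\<omega>\<in>space M. ?f \<omega> > t} \<le> prob {\<omega>\<in>space M. D \<omega> > u}"
      by (intro finite_measure_mono) auto
    also note tail[OF u(1) \<delta>]
    also have "(\<Sum>j\<in>J. prob {\<omega>\<in>space M. \<bar>Y j \<omega>\<bar> > \<kappa> * u})
        = (\<Sum>j\<in>J. prob {\<omega>\<in>space M. \<bar>Y j \<omega>\<bar> powr p > ?s * t})"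
    proof -
      have "\<bar>Y j \<omega>\<bar> > \<kappa> * u \<longleftrightarrow> \<bar>Y j \<omega>\<bar> powr p > ?s * t" for j \<omega>
      proof -
        have "?s * t = (\<kappa> * u) powr p" using u \<open>\<kappa> > 0\<close> by (simp add: powr_mult)
        then show ?thesis
          using \<open>p \<ge> 1\<close> u(1) \<open>\<kappa> > 0\<close> powr_less_mono2[of p "\<kappa> * u" "\<bar>Y j \<omega>\<bar>"]
            powr_mono2[of p "\<bar>Y j \<omega>\<bar>" "\<kappa> * u"]
          by (cases "\<kappa> * u < \<bar>Y j \<omega>\<bar>") (simp_all add: not_less)
      qed
      then show ?thesis by simp
    qed
    finally have "ennreal (prob {\<omega>\<in>space M. ?f \<omega> > t})
        \<le> ennreal ((\<Sum>j\<in>J. prob {\<omega>\<in>space M. \<bar>Y j \<omega>\<bar> powr p > ?s * t}) + R * u powr (- q))"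
      by (rule ennreal_leI)
    also have "\<dots> = (\<Sum>j\<in>J. ?P j (?s * t)) + ennreal R * ennreal (t powr (- (q / p)))"
      using \<open>R \<ge> 0\<close> u(3) by (simp add: ennreal_plus sum_nonneg sum_ennreal ennreal_mult)
    finally show ?thesis .
  qed
  have [measurable]: "(\<lambda>t. ?P j (?s * t)) \<in> borel_measurable borel" if "j \<in> J" for j
    using that by measurable
  have "(\<integral>\<^sup>+t\<in>{A..}. ennreal (prob {\<omega>\<in>space M. ?f \<omega> > t}) \<partial>lborel)
      \<le> (\<integral>\<^sup>+t. (\<Sum>j\<in>J. ?P j (?s * t) * indicator {A..} t)
          + ennreal R * (ennreal (t powr (- (q / p))) * indicator {A..} t) \<partial>lborel)"
    by (intro nn_integral_mono) (use pointwise in \<open>auto simp: indicator_def\<close>)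
  also have "\<dots> = (\<Sum>j\<in>J. \<integral>\<^sup>+t\<in>{A..}. ?P j (?s * t) \<partial>lborel)
      + ennreal R * (\<integral>\<^sup>+t\<in>{A..}. ennreal (t powr (- (q / p))) \<partial>lborel)"
    by (subst nn_integral_add) (auto simp: nn_integral_sum nn_integral_cmult)
  also have "ennreal R * (\<integral>\<^sup>+t\<in>{A..}. ennreal (t powr (- (q / p))) \<partial>lborel)
      = ennreal (R * (A powr (1 - q / p) / (q / p - 1)))"
    using \<open>R \<ge> 0\<close> \<open>A \<ge> 1\<close> \<open>p \<ge> 1\<close> \<open>q > p\<close> by (subst nn_integral_powr_tail) (auto simp: ennreal_mult'[symmetric])
  also have "(\<Sum>j\<in>J. \<integral>\<^sup>+t\<in>{A..}. ?P j (?s * t) \<partial>lborel)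
      \<le> (\<Sum>j\<in>J. ennreal (1 / ?s) * (\<integral>\<^sup>+t\<in>{\<delta> powr p..}. ?P j t \<partial>lborel))"
    using \<open>\<kappa> > 0\<close> \<open>\<delta> powr p \<le> ?s * A\<close> by (intro sum_mono tail_integral_rescale) auto
  also have "\<dots> = ennreal (1 / ?s) * (\<Sum>j\<in>J. \<integral>\<^sup>+t\<in>{\<delta> powr p..}. ?P j t \<partial>lborel)"
    by (simp add: sum_distrib_left)
  finally have I: "(\<integral>\<^sup>+t\<in>{A..}. ennreal (prob {\<omega>\<in>space M. ?f \<omega> > t}) \<partial>lborel)
      \<le> ennreal (1 / ?s) * (\<Sum>j\<in>J. \<integral>\<^sup>+t\<in>{\<delta> powr p..}. ?P j t \<partial>lborel)
        + ennreal (R * (A powr (1 - q / p) / (q / p - 1)))"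
    by (simp add: add_right_mono)
  have "(\<integral>\<^sup>+\<omega>. ennreal (?f \<omega>) \<partial>M) \<le> ennreal (A * prob {\<omega>\<in>space M. ?f \<omega> > 0})
      + (\<integral>\<^sup>+t\<in>{A..}. ennreal (prob {\<omega>\<in>space M. ?f \<omega> > t}) \<partial>lborel)"
    using \<open>A \<ge> 1\<close> by (intro nn_integral_le_tail_integral) auto
  also note add_left_mono[OF I]
  finally show ?thesis unfolding pos by (simp add: add.assoc)
qed

section \<open>Summation over the rows\<close>

text \<open>An asymptotic bound on a sequence is a uniform one, since the finitely many remaining
  values are bounded as well. Hence one truncation fraction \<open>\<kappa>\<close> serves all rows.\<close>

lemma bigo_one_imp_bounded:
  fixes f :: "nat \<Rightarrow> real"
  assumes "f \<in> O(\<lambda>_. 1)"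
  obtains B where "B > 0" "\<And>n. f n \<le> B"
proof -
  obtain c where "eventually (\<lambda>n. norm (f n) \<le> c) sequentially"
    using assms by (auto elim!: landau_o.bigE)
  then have "Bseq f" by (rule BfunI)
  then show ?thesis using that by (auto simp: Bseq_def abs_le_iff)
qed

theorem theorem3:
  fixes M :: "'a measure"
    and k :: "nat \<Rightarrow> nat"
    and X :: "nat \<Rightarrow> nat \<Rightarrow> 'a \<Rightarrow> real"
    and c \<alpha> \<beta> :: "nat \<Rightarrow> real"
    and p q \<delta> :: real
  assumes "prob_space M"
    and "\<And>n. n \<ge> 1 \<Longrightarrow> k n > 0"
    and "filterlim k at_top sequentially"
    and "\<And>n j. n \<ge> 1 \<Longrightarrow> j \<in> {1..k n} \<Longrightarrow> X n j \<in> borel_measurable M"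
    and "p \<ge> 1"
    and "\<And>n. n \<ge> 1 \<Longrightarrow> c n > 0"
    and "\<And>n. n \<ge> 1 \<Longrightarrow> \<alpha> n \<ge> 0"
    and "\<And>n. n \<ge> 1 \<Longrightarrow> \<beta> n \<ge> 0"
    and "maximal_inequality M k X \<alpha> \<beta>"
    and "\<delta> > 0"
    and a: "\<And>x::real. x > 0 \<Longrightarrow>
      (\<Sum>\<^sub>\<infinity>n\<in>{1..}. ennreal (c n * measure M {\<omega>\<in>space M. max_dev M k X \<delta> n \<omega> > x})) < \<infinity>"
    and b1: "(\<lambda>n. Max ((\<lambda>j. measure M {\<omega>\<in>space M. \<bar>X n j \<omega>\<bar> > \<delta>}) ` {1..k n})) \<in> o(\<lambda>_. 1)"
    and b2: "(\<lambda>n. \<Sum>j=1..k n. measure M {\<omega>\<in>space M. \<bar>X n j \<omega>\<bar> > \<delta>}) \<in> O(\<lambda>_. 1)"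
    and c: "(\<Sum>\<^sub>\<infinity>n\<in>{1..}. \<Sum>j=1..k n. ennreal (c n * (1 + \<alpha> n)) *
        (\<integral>\<^sup>+t\<in>{\<delta> powr p..}. ennreal (measure M {\<omega>\<in>space M. \<bar>X n j \<omega>\<bar> powr p > t}) \<partial>lborel)) < \<infinity>"
    and "q > p"
    and d1: "(\<Sum>\<^sub>\<infinity>n\<in>{1..}. ennreal (c n * \<beta> n) *
        (\<integral>\<^sup>+t\<in>{\<delta> powr p..}.
          ennreal ((\<Sum>j=1..k n. measure M {\<omega>\<in>space M. \<bar>X n j \<omega>\<bar> powr p > t}) powr q) \<partial>lborel)) < \<infinity>"
    and d2: "(\<Sum>\<^sub>\<infinity>n\<in>{1..}. ennreal (c n * \<beta> n *
        (\<Sum>j=1..k n. prob_space.variance M (cutoff \<delta> (X n j))) powr q)) < \<infinity>"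
    and d3: "(\<Sum>\<^sub>\<infinity>n\<in>{1..}. ennreal (c n * \<beta> n *
        (\<Sum>j=1..k n. tail_expectation M \<delta> (X n j)) powr q)) < \<infinity>"
  shows "\<forall>\<epsilon>>0. (\<Sum>\<^sub>\<infinity>n\<in>{1..}. ennreal (c n) *
      (\<integral>\<^sup>+\<omega>. ennreal ((max (max_dev M k X \<delta> n \<omega> - \<epsilon>) 0) powr p) \<partial>M)) < \<infinity>"
proof (intro allI impI)
  fix \<epsilon> :: real assume "\<epsilon> > 0"
  interpret prob_space M by fact
  obtain C1 C2 where "C1 > 0" "C2 > 0" and max_ineq: "\<And>n l x \<eta>. n \<ge> 1 \<Longrightarrow> l > 0 \<Longrightarrow> x > 0 \<Longrightarrow> \<eta> > 0 \<Longrightarrow>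
      prob {\<omega>\<in>space M. max_abs_partial_sum (k n) (\<lambda>j. centered_trunc M l (X n j) \<omega>) \<ge> x}
      \<le> \<alpha> n * prob {\<omega>\<in>space M. Max ((\<lambda>j. \<bar>centered_trunc M l (X n j) \<omega>\<bar>) ` {1..k n}) > C1 * \<eta>}
        + \<beta> n * ((\<Sum>j=1..k n. expectation (\<lambda>\<omega>. (centered_trunc M l (X n j) \<omega>)\<^sup>2)) / (C2 * x * \<eta>)) powr (x / \<eta>)"
    using \<open>maximal_inequality M k X \<alpha> \<beta>\<close> unfolding maximal_inequality_def by meson
  obtain B where "B > 0"
    and B: "\<And>n. (\<Sum>j=1..k n. prob {\<omega>\<in>space M. \<bar>X n j \<omega>\<bar> > \<delta>}) \<le> B"
    using bigo_one_imp_bounded[OF b2] by blast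
  have "q > 0" using \<open>p \<ge> 1\<close> \<open>q > p\<close> by simp
  define \<kappa> where "\<kappa> = min 1 (min (1 / (2 * B)) (C1 / (4 * q)))"
  have \<kappa>: "0 < \<kappa>" "\<kappa> \<le> 1" "\<kappa> \<le> 1 / (2 * B)" "\<kappa> \<le> C1 / (4 * q)"
    using \<open>B > 0\<close> \<open>C1 > 0\<close> \<open>q > 0\<close> by (auto simp: \<kappa>_def)
  define A where "A = max 1 ((\<delta> / \<kappa>) powr p)"
  have "A \<ge> 1" by (simp add: A_def)
  have A: "\<delta> powr p \<le> \<kappa> powr p * A"
  proof -
    have "\<kappa> powr p * (\<delta> / \<kappa>) powr p \<le> \<kappa> powr p * A"
      unfolding A_def by (intro mult_left_mono) auto
    then show ?thesis
      using \<kappa> \<open>\<delta> > 0\<close> by (simp add: powr_divide)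
  qed
  define K where "K = (16 * q / C2) powr q * (A powr (1 - q / p) / (q / p - 1))"
  have "K \<ge> 0" using \<open>p \<ge> 1\<close> \<open>q > p\<close> by (auto simp: K_def)
  define I where "I n j = (\<integral>\<^sup>+t\<in>{\<delta> powr p..}. ennreal (prob {\<omega>\<in>space M. \<bar>X n j \<omega>\<bar> powr p > t}) \<partial>lborel)" for n j
  define V where "V n = (\<Sum>j=1..k n. variance (cutoff \<delta> (X n j)))" for n
  define T where "T n = (\<Sum>j=1..k n. tail_expectation M \<delta> (X n j))" for n
  have intX: "integrable M (X n j)" if n: "n \<ge> 1" and j: "j \<in> {1..k n}" for n j
  proof (rule integrable_if_powr_tail_finite)
    have "ennreal (c n * (1 + \<alpha> n)) * I n j \<le> (\<Sum>j=1..k n. ennreal (c n * (1 + \<alpha> n)) * I n j)"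
      using j by (intro member_le_sum) auto
    also have "\<dots> < \<infinity>"
      unfolding I_def by (rule infsum_ennreal_term_finite[OF c]) (use n in simp)
    finally have "ennreal (c n * (1 + \<alpha> n)) * I n j < \<infinity>" .
    moreover have "c n * (1 + \<alpha> n) > 0"
      using assms(6,7)[OF n] by simp
    ultimately have "I n j < \<infinity>"
      by (auto simp: ennreal_mult_less_top)
    then show "(\<integral>\<^sup>+t\<in>{\<delta> powr p..}. ennreal (prob {\<omega>\<in>space M. \<bar>X n j \<omega>\<bar> powr p > t}) \<partial>lborel) < \<infinity>"
      by (simp add: I_def)
  qed (use assms(4)[OF n j] \<open>p \<ge> 1\<close> in auto)
  have row: "ennreal (c n) * (\<integral>\<^sup>+\<omega>. ennreal ((max (max_dev M k X \<delta> n \<omega> - \<epsilon>) 0) powr p) \<partial>M)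
      \<le> ennreal A * ennreal (c n * prob {\<omega>\<in>space M. max_dev M k X \<delta> n \<omega> > \<epsilon>})
        + ennreal (1 / \<kappa> powr p) * (\<Sum>j=1..k n. ennreal (c n * (1 + \<alpha> n)) * I n j)
        + (ennreal K * ennreal (c n * \<beta> n * V n powr q) + ennreal K * ennreal (c n * \<beta> n * T n powr q))"
    (is "_ \<le> ?rhs") if "n \<in> {1..}" for n
  proof -
    have n: "n \<ge> 1" using that by simp
    define R where "R = \<beta> n * (16 * q / C2) powr q * (V n powr q + T n powr q)"
    note cn = assms(6)[OF n] and \<alpha>n = assms(7)[OF n] and \<beta>n = assms(8)[OF n]
    have "\<kappa> * (\<Sum>j=1..k n. prob {\<omega>\<in>space M. \<bar>X n j \<omega>\<bar> > \<delta>}) \<le> 1 / (2 * B) * B"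
      using \<kappa> B \<open>B > 0\<close> by (intro mult_mono sum_nonneg) auto
    then have drift: "\<kappa> * (\<Sum>j=1..k n. prob {\<omega>\<in>space M. \<bar>X n j \<omega>\<bar> > \<delta>}) \<le> 1 / 2"
      using \<open>B > 0\<close> by simp
    have "(\<integral>\<^sup>+\<omega>. ennreal ((max (max_dev M k X \<delta> n \<omega> - \<epsilon>) 0) powr p) \<partial>M)
        \<le> ennreal (A * prob {\<omega>\<in>space M. max_dev M k X \<delta> n \<omega> > \<epsilon>})
          + ennreal (1 / \<kappa> powr p) * (\<Sum>j=1..k n. I n j)
          + ennreal (R * (A powr (1 - q / p) / (q / p - 1)))"
      unfolding I_def
    proof (rule row_moment_bound)
      show "max_dev M k X \<delta> n \<in> borel_measurable M"
        unfolding max_dev_def using assms(2)[OF n] assms(4)[OF n]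
        by (intro max_abs_partial_sum_measurable) auto
      show "prob {\<omega>\<in>space M. max_dev M k X \<delta> n \<omega> > u}
          \<le> (\<Sum>j=1..k n. prob {\<omega>\<in>space M. \<bar>X n j \<omega>\<bar> > \<kappa> * u}) + R * u powr (- q)"
        if "u \<ge> 1" "\<delta> \<le> \<kappa> * u" for u
        unfolding max_dev_def R_def V_def T_def
        by (rule row_tail_bound[OF assms(2)[OF n] intX[OF n] max_ineq[OF n] \<beta>n \<open>C2 > 0\<close> \<open>q > 0\<close>
              \<open>\<delta> > 0\<close> \<kappa>(1,2) drift \<kappa>(4) that])
      show "R \<ge> 0" using \<beta>n by (simp add: R_def)
    qed (use assms(4)[OF n] \<kappa> A \<open>A \<ge> 1\<close> \<open>\<epsilon> > 0\<close> \<open>\<delta> > 0\<close> \<open>p \<ge> 1\<close> \<open>q > p\<close> in auto)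
    then have "ennreal (c n) * (\<integral>\<^sup>+\<omega>. ennreal ((max (max_dev M k X \<delta> n \<omega> - \<epsilon>) 0) powr p) \<partial>M)
        \<le> ennreal (c n) * (ennreal (A * prob {\<omega>\<in>space M. max_dev M k X \<delta> n \<omega> > \<epsilon>})
          + ennreal (1 / \<kappa> powr p) * (\<Sum>j=1..k n. I n j)
          + ennreal (R * (A powr (1 - q / p) / (q / p - 1))))"
      by (rule mult_left_mono) simp
    also have "\<dots> = ennreal (c n) * ennreal (A * prob {\<omega>\<in>space M. max_dev M k X \<delta> n \<omega> > \<epsilon>})
          + ennreal (1 / \<kappa> powr p) * (\<Sum>j=1..k n. ennreal (c n) * I n j)
          + ennreal (c n) * ennreal (R * (A powr (1 - q / p) / (q / p - 1)))"
      by (simp add: distrib_left sum_distrib_left mult_ac)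
    also have "\<dots> \<le> ?rhs"
    proof (intro add_mono)
      show "ennreal (c n) * ennreal (A * prob {\<omega>\<in>space M. max_dev M k X \<delta> n \<omega> > \<epsilon>})
          \<le> ennreal A * ennreal (c n * prob {\<omega>\<in>space M. max_dev M k X \<delta> n \<omega> > \<epsilon>})"
        using cn \<open>A \<ge> 1\<close> by (simp add: ennreal_mult mult_ac)
      show "ennreal (1 / \<kappa> powr p) * (\<Sum>j=1..k n. ennreal (c n) * I n j)
          \<le> ennreal (1 / \<kappa> powr p) * (\<Sum>j=1..k n. ennreal (c n * (1 + \<alpha> n)) * I n j)"
        using cn \<alpha>n by (intro mult_left_mono sum_mono mult_right_mono ennreal_leI) auto
      have "ennreal (c n) * ennreal (R * (A powr (1 - q / p) / (q / p - 1)))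
          = ennreal (K * (c n * \<beta> n * V n powr q) + K * (c n * \<beta> n * T n powr q))"
        using cn by (simp add: ennreal_mult'[symmetric] R_def K_def algebra_simps)
      then show "ennreal (c n) * ennreal (R * (A powr (1 - q / p) / (q / p - 1)))
          \<le> ennreal K * ennreal (c n * \<beta> n * V n powr q) + ennreal K * ennreal (c n * \<beta> n * T n powr q)"
        using cn \<beta>n \<open>K \<ge> 0\<close> by (simp add: ennreal_mult')
    qed
    finally show ?thesis .
  qed
  show "(\<Sum>\<^sub>\<infinity>n\<in>{1..}. ennreal (c n) *
      (\<integral>\<^sup>+\<omega>. ennreal ((max (max_dev M k X \<delta> n \<omega> - \<epsilon>) 0) powr p) \<partial>M)) < \<infinity>"
    by (rule infsum_ennreal_mono_finite[OF _ row], intro infsum_ennreal_add_finite infsum_ennreal_cmult_finite)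
      (use a[OF \<open>\<epsilon> > 0\<close>] c d2 d3 in \<open>simp_all add: I_def V_def T_def\<close>)
qed

end
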